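(* Let $f_0,f_1,F_0,F_1,\Phi,\Psi$ be the mock theta functions of order five defined in the context. Then for every integer $k\ge 2$ and each choice of sign, at the point $q=\pm 1/k$ each of the six values $f_0(q)$, $f_1(q)$, $F_0(q)$, $F_1(q)$, $\Phi(q)$, $\Psi(q)$ is an irrational number.
   Context: For complex $a,q$ and an integer $n\ge 0$, the $q$-Pochhammer symbol is $(a;q)_n=\prod_{j=0}^{n-1}(1-aq^j)$, with $(a;q)_0=1$. For $q\in\mathbb{C}$ with $|q|<1$ (and $q$ such that no denominator below vanishes, which is automatic for $|q|<1$), define $$f_0(q)=\sum_{n=0}^{\infty}\frac{q^{n^2}}{(-q;q)_n},\qquad f_1(q)=\sum_{n=0}^{\infty}\frac{q^{n(n+1)}}{(-q;q)_n},$$ $$F_0(q)=\sum_{n=0}^{\infty}\frac{q^{2n^2}}{(q;q^2)_n},\qquad F_1(q)=\sum_{n=0}^{\infty}\frac{q^{2n(n+1)}}{(q;q^2)_{n+1}},$$ $$\Phi(q)=-1+\sum_{n=0}^{\infty}\frac{q^{5n^2}}{(q;q^5)_{n+1}\,(q^4;q^5)_n},\qquad \Psi(q)=-1+\sum_{n=0}^{\infty}\frac{q^{5n^2}}{(q^2;q^5)_{n+1}\,(q^3;q^5)_n}.$$ *)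

theory Defs
  imports Complex_Main
begin

definition qpoch :: "complex \<Rightarrow> complex \<Rightarrow> nat \<Rightarrow> complex" where
  "qpoch a q n = (\<Prod>j<n. 1 - a * q ^ j)"

text \<open>
  The mock theta functions of order five. They are only meaningful for \<open>norm q < 1\<close>, where
  no denominator vanishes and all the series converge.
\<close>

definition mock_f0 :: "complex \<Rightarrow> complex" where
  "mock_f0 q = (\<Sum>n. q ^ (n\<^sup>2) / qpoch (- q) q n)"

definition mock_f1 :: "complex \<Rightarrow> complex" where
  "mock_f1 q = (\<Sum>n. q ^ (n * (n + 1)) / qpoch (- q) q n)"

definition mock_F0 :: "complex \<Rightarrow> complex" where
  "mock_F0 q = (\<Sum>n. q ^ (2 * n\<^sup>2) / qpoch q (q\<^sup>2) n)"

definition mock_F1 :: "complex \<Rightarrow> complex" where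
  "mock_F1 q = (\<Sum>n. q ^ (2 * n * (n + 1)) / qpoch q (q\<^sup>2) (n + 1))"

definition mock_Phi :: "complex \<Rightarrow> complex" where
  "mock_Phi q =
    - 1 + (\<Sum>n. q ^ (5 * n\<^sup>2) / (qpoch q (q ^ 5) (n + 1) * qpoch (q ^ 4) (q ^ 5) n))"

definition mock_Psi :: "complex \<Rightarrow> complex" where
  "mock_Psi q =
    - 1 + (\<Sum>n. q ^ (5 * n\<^sup>2) / (qpoch (q\<^sup>2) (q ^ 5) (n + 1) * qpoch (q ^ 3) (q ^ 5) n))"

end

theory Submission
  imports Defs
begin

text \<open>
  Write \<open>q = 1/m\<close> with an integer \<open>m\<close>, \<open>\<bar>m\<bar> \<ge> 2\<close>. In each of the six series the term \<open>t n\<close>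
  satisfies \<open>t (n+1) = t n * q ^ u n / p n\<close>, where \<open>u n\<close> is linear in \<open>n\<close> and the new factor
  \<open>p n\<close> of the denominator tends to 1. Clearing denominators in \<open>p n\<close> costs \<open>m ^ v n\<close> for an
  exponent with \<open>u n \<le> v n < u (n+1)\<close>. Consequently \<open>D n = D 0 * (\<Prod>j<n. m ^ v j * p j)\<close>
  with \<open>D 0\<close> the denominator of \<open>t 0\<close> is a common denominator of \<open>t 0, \<dots>, t n\<close>:
  the bound \<open>u n \<le> v n\<close> makes \<open>D n * t n\<close> an integer.
  The bound \<open>v n < u (n+1)\<close> makes the quotient of consecutive values of \<open>D n * t (n+1)\<close>
  asymptotically at most \<open>1/2\<close> in norm, so that \<open>D n * t (n+1) \<longlonglongrightarrow> 0\<close>. As the terms decrease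
  superexponentially, the tail \<open>t (n+1) + t (n+2) + \<dots>\<close> is comparable to \<open>t (n+1)\<close>; it
  is therefore nonzero, and is \<open>o(1 / D n)\<close>. If the sum were rational with denominator \<open>b\<close>, then \<open>b * D n\<close>
  times this tail would be a nonzero integer tending to 0. This is
  \<open>suminf_irrational_if_term_ratio\<close>; it then remains to exhibit \<open>u\<close>, \<open>v\<close> and \<open>p\<close> for each
  of the six series.
\<close>

section \<open>Series with rapidly decreasing terms\<close>

text \<open>The tail of a series whose terms shrink by a factor 4 is comparable to its first term.\<close>

lemma
  fixes t :: "nat \<Rightarrow> 'a::{real_normed_field,banach}"
  assumes ratio: "\<And>n. norm (t (Suc n)) \<le> norm (t n) / 4"
  shows summable_if_quarter_ratio: "summable t"
    and norm_suminf_minus_first_le: "norm (suminf t - t 0) \<le> norm (t 0) / 2"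
proof -
  have bound: "norm (t n) \<le> norm (t 0) * (1/4) ^ n" for n
  proof (induction n)
    case (Suc n)
    then show ?case using ratio[of n] by simp
  qed simp
  have geo: "(\<lambda>n. norm (t 0) * (1/4) ^ n) sums (norm (t 0) * (1 / (1 - 1/4)))"
    by (intro sums_mult geometric_sums) simp
  show summable: "summable t"
    using bound by (intro summable_comparison_test'[OF sums_summable[OF geo]]) auto
  have geo': "(\<lambda>n. norm (t 0) / 4 * (1/4) ^ n) sums (norm (t 0) / 4 * (1 / (1 - 1/4)))"
    by (intro sums_mult geometric_sums) simp
  have "norm (\<Sum>n. t (Suc n)) \<le> (\<Sum>n. norm (t 0) / 4 * (1/4) ^ n)"
    using bound[of "Suc _"] by (intro norm_suminf_le sums_summable[OF geo']) simp
  also have "\<dots> = norm (t 0) / 3"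
    using sums_unique[OF geo'] by simp
  also have "\<dots> \<le> norm (t 0) / 2"
    by simp
  finally show "norm (suminf t - t 0) \<le> norm (t 0) / 2"
    using suminf_split_head[OF summable] by simp
qed

section \<open>An irrationality criterion\<close>

lemma power_mult_power_one_over:
  fixes x :: "'a::field"
  assumes "x \<noteq> 0" "a \<le> b"
  shows "x ^ b * (1 / x) ^ a = x ^ (b - a)"
  using assms by (simp add: power_diff power_one_over)

text \<open>
  Here \<open>D n\<close> is a common denominator of \<open>t 0, \<dots>, t n\<close>, since \<open>D i\<close> divides \<open>D n\<close> for \<open>i \<le> n\<close>. A rational
  sum with denominator \<open>b\<close> would turn \<open>b * D n\<close> times the tail into an integer, which for large
  \<open>n\<close> is nonzero and of norm less than 1.
\<close>

lemma suminf_irrational_if_denominators: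
  fixes t :: "nat \<Rightarrow> complex" and D :: "nat \<Rightarrow> int"
  assumes nz: "\<And>n. t n \<noteq> 0" "\<And>n. D n \<noteq> 0"
    and ratio: "eventually (\<lambda>n. norm (t (Suc n)) \<le> norm (t n) / 4) sequentially"
    and dvd: "\<And>n. D n dvd D (Suc n)"
    and int: "\<And>n. of_int (D n) * t n \<in> \<int>"
    and lim: "(\<lambda>n. of_int (D n) * t (Suc n)) \<longlonglongrightarrow> 0"
  shows "suminf t \<in> \<real> - \<rat>"
proof
  obtain N where N: "\<And>n. n \<ge> N \<Longrightarrow> norm (t (Suc n)) \<le> norm (t n) / 4"
    using ratio by (auto simp: eventually_sequentially)
  have "summable (\<lambda>n. t (n + N))"
    using N by (intro summable_if_quarter_ratio) simp
  then have summable: "summable t"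
    by simp
  have rat: "t n \<in> \<rat>" for n
  proof -
    have "t n = (of_int (D n) * t n) / of_int (D n)"
      using nz by simp
    then show ?thesis
      using int[of n] by (metis Ints_subset_Rats Rats_divide Rats_of_int subsetD)
  qed
  have "Im (t n) = 0" for n
    using rat[of n] by (metis Rats_cases' Reals_divide Reals_of_int complex_is_Real_iff)
  then show "suminf t \<in> \<real>"
    using bounded_linear.suminf[OF bounded_linear_Im summable] by (simp add: complex_is_Real_iff)
  show "suminf t \<notin> \<rat>"
  proof
    assume "suminf t \<in> \<rat>"
    then obtain a b :: int where b: "b > 0" and ab: "suminf t = of_int a / of_int b"
      by (auto elim!: Rats_cases')
    have tail: "norm ((\<Sum>i. t (i + n)) - t n) \<le> norm (t n) / 2" if "n \<ge> N" for n
      using norm_suminf_minus_first_le[of "\<lambda>i. t (i + n)"] N that by simp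
    have "(\<lambda>n. of_int b * (of_int (D n) * t (Suc n))) \<longlonglongrightarrow> of_int b * 0"
      by (intro tendsto_mult tendsto_const lim)
    then have "eventually (\<lambda>n. norm (of_int b * (of_int (D n) * t (Suc n))) < 1/2) sequentially"
      by (auto dest!: tendstoD[where e = "1/2"] simp: dist_norm)
    then obtain n where n: "n \<ge> N"
      and small: "norm (of_int b * (of_int (D n) * t (Suc n))) < 1/2"
      using eventually_happens'[OF sequentially_bot eventually_conj[OF eventually_ge_at_top[of N]]]
      by blast
    define R where "R = (\<Sum>i. t (i + Suc n))"
    have R: "norm (R - t (Suc n)) \<le> norm (t (Suc n)) / 2"
      using tail[of "Suc n"] n by (simp add: R_def)
    have "R \<noteq> 0"
      using R nz(1)[of "Suc n"] by (auto simp: norm_minus_commute)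
    have "norm R \<le> 2 * norm (t (Suc n))"
      using R norm_triangle_sub[of R "t (Suc n)"] norm_ge_zero[of "t (Suc n)"] by linarith
    then have "norm (of_int (b * D n) * R) \<le> norm (of_int (b * D n) :: complex) * (2 * norm (t (Suc n)))"
      unfolding norm_mult by (intro mult_left_mono) simp_all
    also have "\<dots> < 1"
      using small by (simp add: norm_mult)
    finally have less: "norm (of_int (b * D n) * R) < 1" .
    have "of_int (D n) * t i \<in> \<int>" if "i \<le> n" for i
    proof -
      have "D i dvd D n"
        using that by (induction rule: dec_induct) (auto intro: dvd_trans dvd)
      then obtain c where "D n = c * D i"
        by (metis dvdE mult.commute)
      then have "of_int (D n) * t i = of_int c * (of_int (D i) * t i)"
        by simp
      then show ?thesis
        using int[of i] by (metis Ints_mult Ints_of_int)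
    qed
    then have "of_int b * (\<Sum>i<Suc n. of_int (D n) * t i) \<in> \<int>"
      by (intro Ints_mult[OF Ints_of_int Ints_sum]) auto
    moreover have "of_int (b * D n) * R =
        of_int (D n * a) - of_int b * (\<Sum>i<Suc n. of_int (D n) * t i)"
    proof -
      have "R = suminf t - (\<Sum>i<Suc n. t i)"
        using suminf_split_initial_segment[OF summable, of "Suc n"] by (simp add: R_def)
      moreover have "of_int a = of_int b * suminf t"
        using b ab by simp
      ultimately show ?thesis
        by (simp add: sum_distrib_left[symmetric] right_diff_distrib del: sum.lessThan_Suc)
    qed
    ultimately have "of_int (b * D n) * R \<in> \<int>"
      by (metis Ints_diff Ints_of_int)
    then obtain z :: int where z: "of_int (b * D n) * R = of_int z"
      by (auto elim: Ints_cases)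
    then have "\<bar>z\<bar> < 1"
      using less by (simp add: norm_of_int)
    then show False
      using z b nz(2)[of n] \<open>R \<noteq> 0\<close> by simp
  qed
qed

text \<open>
  The criterion in the form in which it is applied: \<open>p n\<close> is the factor by which the denominator
  grows from one term to the next, and \<open>m ^ v n\<close> clears the denominators of \<open>p n\<close>.
\<close>

lemma suminf_irrational_if_term_ratio:
  fixes m :: int and p t :: "nat \<Rightarrow> complex" and u v :: "nat \<Rightarrow> nat"
  assumes m: "\<bar>m\<bar> \<ge> 2"
    and t0: "t 0 \<in> \<rat>" "t 0 \<noteq> 0"
    and rec: "\<And>n. t (Suc n) = t n * (1 / of_int m) ^ u n / p n"
    and p: "\<And>n. p n \<noteq> 0" "p \<longlonglongrightarrow> 1"
    and int: "\<And>n. of_int m ^ v n * p n \<in> \<int>"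
    and uv: "\<And>n. u n \<le> v n" "\<And>n. v n < u (Suc n)"
  shows "suminf t \<in> \<real> - \<rat>"
proof -
  have m0: "m \<noteq> 0" and m1: "norm (1 / of_int m :: complex) \<le> 1/2"
    using m by (auto simp: norm_divide divide_simps)
  have "\<forall>n. \<exists>b. of_int m ^ v n * p n = of_int b"
    using int by (auto elim: Ints_cases)
  then obtain b where b: "\<And>n. of_int m ^ v n * p n = of_int (b n)"
    by metis
  have b0: "b n \<noteq> 0" for n
    using b[of n] p(1)[of n] m0 by auto
  obtain a d :: int where d: "d > 0" and ad: "t 0 = of_int a / of_int d"
    using t0(1) by (auto elim!: Rats_cases')
  define D where "D n = d * (\<Prod>j<n. b j)" for n
  have DSuc: "D (Suc n) = D n * b n" for n
    by (simp add: D_def)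
  have D0: "D n \<noteq> 0" for n
    using d b0 by (simp add: D_def)
  have tnz: "t n \<noteq> 0" for n
    by (induction n) (use t0 rec p m0 in auto)
  have "of_int (D n) * t n \<in> \<int>" for n
  proof (induction n)
    case 0
    then show ?case
      using d by (simp add: D_def ad)
  next
    case (Suc n)
    have "of_int (D (Suc n)) * t (Suc n) =
        of_int (D n) * t n * (of_int m ^ v n * (1 / of_int m) ^ u n)"
      using p(1)[of n] by (simp add: DSuc rec b[symmetric])
    also have "of_int m ^ v n * (1 / of_int m :: complex) ^ u n = of_int (m ^ (v n - u n))"
      using m0 uv(1)[of n] by (simp add: power_mult_power_one_over)
    finally show ?case
      using Suc by (metis Ints_mult Ints_of_int)
  qed
  moreover have "eventually (\<lambda>n. norm (t (Suc n)) \<le> norm (t n) / 4) sequentially"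
  proof -
    have un: "n \<le> u n" for n
    proof (induction n)
      case (Suc n)
      then show ?case using uv(1)[of n] uv(2)[of n] by simp
    qed simp
    have "(\<lambda>n. norm (p n)) \<longlonglongrightarrow> norm (1 :: complex)"
      by (intro tendsto_norm p)
    then have "eventually (\<lambda>n. norm (p n) > 1/2) sequentially"
      by (rule order_tendstoD) simp
    then show ?thesis
      using eventually_ge_at_top[of 3]
    proof eventually_elim
      case (elim n)
      have "norm ((1 / of_int m :: complex) ^ u n) \<le> (1/2) ^ u n"
        unfolding norm_power using m1 by (intro power_mono) auto
      also have "\<dots> \<le> (1/2) ^ 3"
        using un[of n] elim(2) by (intro power_decreasing) auto
      also have "\<dots> \<le> norm (p n) / 4"
        using elim(1) by (simp add: power3_eq_cube)
      finally have "norm (t n) * norm ((1 / of_int m :: complex) ^ u n) \<le> norm (t n) * (norm (p n) / 4)"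
        by (rule mult_left_mono) simp
      then show ?case
        using p(1)[of n] unfolding rec norm_mult norm_divide[of _ "p n"] by (simp add: field_simps)
    qed
  qed
  moreover have "(\<lambda>n. of_int (D n) * t (Suc n)) \<longlonglongrightarrow> 0"
  proof -
    let ?s = "\<lambda>n. of_int (D n) * t (Suc n)"
    have "(\<lambda>n. norm (p n / p (Suc n))) \<longlonglongrightarrow> norm (1 / 1 :: complex)"
      by (intro tendsto_norm tendsto_divide p filterlim_compose[OF p(2) filterlim_Suc]) simp
    then have "eventually (\<lambda>n. norm (p n / p (Suc n)) < 3/2) sequentially"
      by (rule order_tendstoD) simp
    then obtain N where N: "\<And>n. n \<ge> N \<Longrightarrow> norm (p n / p (Suc n)) < 3/2"
      by (auto simp: eventually_sequentially)
    have "norm (?s (Suc n)) \<le> 3/4 * norm (?s n)" if "n \<ge> N" for n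
    proof -
      have "?s (Suc n) = ?s n * (of_int m ^ v n * (1 / of_int m) ^ u (Suc n)) * (p n / p (Suc n))"
        by (simp add: DSuc rec[of "Suc n"] b[symmetric])
      also have "of_int m ^ v n * (1 / of_int m :: complex) ^ u (Suc n) =
          (1 / of_int m) ^ (u (Suc n) - v n)"
        using m0 uv(2)[of n] by (simp add: power_diff power_one_over divide_simps)
      finally have eq: "norm (?s (Suc n)) =
          norm (?s n) * (norm (1 / of_int m :: complex) ^ (u (Suc n) - v n) * norm (p n / p (Suc n)))"
        by (simp only: norm_mult norm_power mult.assoc)
      have "norm (1 / of_int m :: complex) ^ (u (Suc n) - v n) \<le> (1/2) ^ (u (Suc n) - v n)"
        using m1 by (intro power_mono) auto
      also have "\<dots> \<le> (1/2) ^ 1"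
        using uv(2)[of n] by (intro power_decreasing) auto
      finally have "norm (1 / of_int m :: complex) ^ (u (Suc n) - v n) * norm (p n / p (Suc n))
          \<le> 1/2 * (3/2)"
        using less_imp_le[OF N[OF that]] by (intro mult_mono) auto
      from mult_left_mono[OF this norm_ge_zero[of "?s n"]] show ?thesis
        unfolding eq by simp
    qed
    then have "summable ?s"
      by (intro summable_ratio_test[of "3/4" N]) auto
    then show ?thesis
      by (rule summable_LIMSEQ_zero)
  qed
  ultimately show ?thesis
    using tnz D0 by (intro suminf_irrational_if_denominators) (auto simp: DSuc)
qed

section \<open>The factors of the denominators\<close>

lemma Ints_power_mult_one_minus:
  fixes m :: int
  assumes "m \<noteq> 0" "a \<le> b"
  shows "of_int m ^ b * (1 - (1 / of_int m) ^ a) \<in> (\<int> :: complex set)"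
    and "of_int m ^ b * (1 + (1 / of_int m) ^ a) \<in> (\<int> :: complex set)"
proof -
  have *: "of_int m ^ b * (1 / of_int m :: complex) ^ a = of_int (m ^ (b - a))"
    using assms by (simp add: power_mult_power_one_over)
  show "of_int m ^ b * (1 - (1 / of_int m) ^ a) \<in> (\<int> :: complex set)"
    and "of_int m ^ b * (1 + (1 / of_int m) ^ a) \<in> (\<int> :: complex set)"
    unfolding right_diff_distrib distrib_left * by auto
qed

lemma one_plus_minus_power_nonzero:
  fixes q :: complex
  assumes "norm q < 1" "n > 0"
  shows "1 - q ^ n \<noteq> 0" "1 + q ^ n \<noteq> 0"
proof -
  have "norm (q ^ n) < 1"
    using assms by (simp add: norm_power power_less_one_iff)
  then show "1 - q ^ n \<noteq> 0" "1 + q ^ n \<noteq> 0"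
    by (auto simp: add_eq_0_iff)
qed

lemma power_subseq_tendsto_zero:
  fixes q :: complex
  assumes "norm q < 1" "strict_mono g"
  shows "(\<lambda>n. q ^ g n) \<longlonglongrightarrow> 0"
  using filterlim_compose[OF LIMSEQ_power_zero[OF assms(1)] filterlim_subseq[OF assms(2)]] .

lemma qpoch_Suc: "qpoch a q (Suc n) = qpoch a q n * (1 - a * q ^ n)"
  by (simp add: qpoch_def)

lemma qpoch_0 [simp]: "qpoch a q 0 = 1"
  by (simp add: qpoch_def)

section \<open>The mock theta functions of order five\<close>

context
  fixes m :: int and q :: complex
  assumes m: "\<bar>m\<bar> \<ge> 2" and q_def: "q = 1 / of_int m"
begin

lemma m_nonzero: "m \<noteq> 0"
  using m by auto

lemma q_small: "norm q < 1"
  using m by (auto simp: q_def norm_divide divide_simps)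

lemma q_rational: "q \<in> \<rat>"
  by (simp add: q_def)

lemmas q_ints = Ints_power_mult_one_minus[OF m_nonzero, folded q_def]
lemmas q_nz = one_plus_minus_power_nonzero[OF q_small]
lemmas q_lim = power_subseq_tendsto_zero[OF q_small]
lemmas q_criterion = suminf_irrational_if_term_ratio[OF m, folded q_def]

lemma q_ints2:
  assumes "a + b \<le> c"
  shows "of_int m ^ c * ((1 - q ^ a) * (1 - q ^ b)) \<in> \<int>"
proof -
  have "of_int m ^ c * ((1 - q ^ a) * (1 - q ^ b)) =
      (of_int m ^ (c - b) * (1 - q ^ a)) * (of_int m ^ b * (1 - q ^ b))"
    using assms by (simp add: power_add[symmetric] mult.assoc mult.left_commute)
  then show ?thesis
    using assms q_ints(1)[of a "c - b"] q_ints(1)[of b b] by (metis Ints_mult add_le_imp_le_diff order_refl)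
qed

lemma mock_f0_irrational: "mock_f0 q \<in> \<real> - \<rat>"
  unfolding mock_f0_def
proof (rule q_criterion)
  fix n
  have "(Suc n)\<^sup>2 = n\<^sup>2 + (2 * n + 1)"
    by (simp add: power2_eq_square)
  then show "q ^ ((Suc n)\<^sup>2) / qpoch (- q) q (Suc n) =
      q ^ (n\<^sup>2) / qpoch (- q) q n * q ^ (2 * n + 1) / (1 + q ^ (n + 1))"
    by (simp only: qpoch_Suc power_add[of q "n\<^sup>2"]) simp
  show "of_int m ^ (2 * n + 1) * (1 + q ^ (n + 1)) \<in> \<int>"
    by (rule q_ints) simp
  show "(1 + q ^ (n + 1)) \<noteq> 0"
    by (rule q_nz) simp
  show "(\<lambda>n. 1 + q ^ (n + 1)) \<longlonglongrightarrow> 1"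
    using tendsto_add[OF tendsto_const q_lim[of "\<lambda>n. n + 1"]] by (simp add: strict_mono_def)
qed (use m_nonzero in \<open>simp_all\<close>)

lemma mock_f1_irrational: "mock_f1 q \<in> \<real> - \<rat>"
  unfolding mock_f1_def
proof (rule q_criterion)
  fix n
  have "Suc n * (Suc n + 1) = n * (n + 1) + (2 * n + 2)"
    by simp
  then show "q ^ (Suc n * (Suc n + 1)) / qpoch (- q) q (Suc n) =
      q ^ (n * (n + 1)) / qpoch (- q) q n * q ^ (2 * n + 2) / (1 + q ^ (n + 1))"
    by (simp only: qpoch_Suc power_add[of q "n * (n + 1)"]) simp
  show "of_int m ^ (2 * n + 2) * (1 + q ^ (n + 1)) \<in> \<int>"
    by (rule q_ints) simp
  show "(1 + q ^ (n + 1)) \<noteq> 0"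
    by (rule q_nz) simp
  show "(\<lambda>n. 1 + q ^ (n + 1)) \<longlonglongrightarrow> 1"
    using tendsto_add[OF tendsto_const q_lim[of "\<lambda>n. n + 1"]] by (simp add: strict_mono_def)
qed (use m_nonzero in \<open>simp_all\<close>)

lemma mock_F0_irrational: "mock_F0 q \<in> \<real> - \<rat>"
  unfolding mock_F0_def
proof (rule q_criterion)
  fix n
  have "2 * (Suc n)\<^sup>2 = 2 * n\<^sup>2 + (4 * n + 2)"
    by (simp add: power2_eq_square)
  then show "q ^ (2 * (Suc n)\<^sup>2) / qpoch q (q\<^sup>2) (Suc n) =
      q ^ (2 * n\<^sup>2) / qpoch q (q\<^sup>2) n * q ^ (4 * n + 2) / (1 - q ^ (2 * n + 1))"
    by (simp only: qpoch_Suc power_add) (simp add: power_mult)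
  show "of_int m ^ (4 * n + 2) * (1 - q ^ (2 * n + 1)) \<in> \<int>"
    by (rule q_ints) simp
  show "(1 - q ^ (2 * n + 1)) \<noteq> 0"
    by (rule q_nz) simp
  show "(\<lambda>n. 1 - q ^ (2 * n + 1)) \<longlonglongrightarrow> 1"
    using tendsto_diff[OF tendsto_const q_lim[of "\<lambda>n. 2 * n + 1"]] by (simp add: strict_mono_def)
qed (use m_nonzero in \<open>simp_all\<close>)

lemma mock_F1_irrational: "mock_F1 q \<in> \<real> - \<rat>"
  unfolding mock_F1_def
proof (rule q_criterion)
  fix n
  have "2 * Suc n * (Suc n + 1) = 2 * n * (n + 1) + (4 * n + 4)"
    by simp
  moreover have "1 - q * (q\<^sup>2) ^ Suc n = 1 - q ^ (2 * n + 3)"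
    by (simp add: ac_simps eval_nat_numeral flip: power_mult power_add power_Suc)
  ultimately show "q ^ (2 * Suc n * (Suc n + 1)) / qpoch q (q\<^sup>2) (Suc n + 1) =
      q ^ (2 * n * (n + 1)) / qpoch q (q\<^sup>2) (n + 1) * q ^ (4 * n + 4) / (1 - q ^ (2 * n + 3))"
    by (simp only: Suc_eq_plus1[symmetric] qpoch_Suc[of _ _ "Suc n"]
        power_add[of q "2 * n * Suc n"]) simp
  show "of_int m ^ (4 * n + 4) * (1 - q ^ (2 * n + 3)) \<in> \<int>"
    by (rule q_ints) simp
  show "(1 - q ^ (2 * n + 3)) \<noteq> 0"
    by (rule q_nz) simp
  show "(\<lambda>n. 1 - q ^ (2 * n + 3)) \<longlonglongrightarrow> 1"
    using tendsto_diff[OF tendsto_const q_lim[of "\<lambda>n. 2 * n + 3"]] by (simp add: strict_mono_def)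
qed (use m_nonzero q_rational q_nz[of 1] in \<open>simp_all add: qpoch_Suc\<close>)

text \<open>
  Up to the summand \<open>- 1\<close>, the functions \<open>\<Phi>\<close> and \<open>\<Psi>\<close> are the cases \<open>i = 1\<close> and \<open>i = 2\<close>. Two factors enter the
  denominator at each step, whose exponents add up to \<open>10 * n + 10\<close>; this lies strictly between
  the exponents \<open>10 * n + 5\<close> and \<open>10 * n + 15\<close> of consecutive quotients of numerators.
\<close>

lemma order_five_series_irrational:
  assumes i: "0 < i" "i < 5"
  shows "(\<Sum>n. q ^ (5 * n\<^sup>2) / (qpoch (q ^ i) (q ^ 5) (n + 1) * qpoch (q ^ (5 - i)) (q ^ 5) n))
           \<in> \<real> - \<rat>"
proof (rule q_criterion)
  fix n
  have "5 * (Suc n)\<^sup>2 = 5 * n\<^sup>2 + (10 * n + 5)"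
    by (simp add: power2_eq_square)
  moreover have "1 - q ^ i * (q ^ 5) ^ Suc n = 1 - q ^ (5 * n + (5 + i))"
    "1 - q ^ (5 - i) * (q ^ 5) ^ n = 1 - q ^ (5 * n + (5 - i))"
    by (simp_all add: ac_simps flip: power_mult power_add power_Suc)
  ultimately show "q ^ (5 * (Suc n)\<^sup>2) /
        (qpoch (q ^ i) (q ^ 5) (Suc n + 1) * qpoch (q ^ (5 - i)) (q ^ 5) (Suc n)) =
      q ^ (5 * n\<^sup>2) / (qpoch (q ^ i) (q ^ 5) (n + 1) * qpoch (q ^ (5 - i)) (q ^ 5) n) *
        q ^ (10 * n + 5) / ((1 - q ^ (5 * n + (5 + i))) * (1 - q ^ (5 * n + (5 - i))))"
    by (simp only: Suc_eq_plus1[symmetric] qpoch_Suc[of _ _ "Suc n"] qpoch_Suc[of "q ^ (5 - i)"]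
        power_add[of q "5 * n\<^sup>2"]) simp
  show "of_int m ^ (10 * n + 10) * ((1 - q ^ (5 * n + (5 + i))) * (1 - q ^ (5 * n + (5 - i)))) \<in> \<int>"
    by (rule q_ints2) (use i in simp)
  show "(1 - q ^ (5 * n + (5 + i))) * (1 - q ^ (5 * n + (5 - i))) \<noteq> 0"
    using i q_nz(1)[of "5 * n + (5 + i)"] q_nz(1)[of "5 * n + (5 - i)"] by auto
  show "(\<lambda>n. (1 - q ^ (5 * n + (5 + i))) * (1 - q ^ (5 * n + (5 - i)))) \<longlonglongrightarrow> 1"
    using tendsto_mult[OF tendsto_diff[OF tendsto_const[of 1] q_lim[of "\<lambda>n. 5 * n + (5 + i)"]]
        tendsto_diff[OF tendsto_const[of 1] q_lim[of "\<lambda>n. 5 * n + (5 - i)"]]]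
    by (simp add: strict_mono_def)
qed (use m_nonzero q_rational q_nz[of i] i in \<open>simp_all add: qpoch_Suc\<close>)

end

lemma minus_one_plus_irrational:
  fixes x :: complex
  assumes "x \<in> \<real> - \<rat>"
  shows "- 1 + x \<in> \<real> - \<rat>"
proof -
  have "x \<in> \<rat>" if "- 1 + x \<in> \<rat>"
    using Rats_add[OF that Rats_1] by simp
  then show ?thesis
    using assms by (auto intro!: Reals_diff)
qed

theorem theorem3p1:
  fixes k :: int and q :: complex
  assumes "k \<ge> 2"
    and "q = 1 / of_int k \<or> q = - (1 / of_int k)"
  shows "mock_f0 q \<in> \<real> - \<rat> \<and> mock_f1 q \<in> \<real> - \<rat> \<and>
         mock_F0 q \<in> \<real> - \<rat> \<and> mock_F1 q \<in> \<real> - \<rat> \<and>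
         mock_Phi q \<in> \<real> - \<rat> \<and> mock_Psi q \<in> \<real> - \<rat>"
proof -
  obtain m :: int where m: "\<bar>m\<bar> \<ge> 2" "q = 1 / of_int m"
  proof (cases "q = 1 / of_int k")
    case True
    then show ?thesis using that[of k] assms(1) by simp
  next
    case False
    then show ?thesis using that[of "- k"] assms by simp
  qed
  have "mock_Phi q \<in> \<real> - \<rat>"
    using order_five_series_irrational[OF m, of 1]
    unfolding mock_Phi_def by (intro minus_one_plus_irrational) simp
  moreover have "mock_Psi q \<in> \<real> - \<rat>"
    using order_five_series_irrational[OF m, of 2]
    unfolding mock_Psi_def by (intro minus_one_plus_irrational) simp
  ultimately show ?thesis
    using mock_f0_irrational[OF m] mock_f1_irrational[OF m]
      mock_F0_irrational[OF m] mock_F1_irrational[OF m] by blast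
qed

end
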